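(* Let $r\geq 2$ and $s$ be fixed positive integers, and write $s=dr+p$ with $d,p$ non-negative integers and $0\leq p<r$. Then there exists $n_0(r,s)$ such that if $n>n_0(r,s)$ and $A\subset\mathbb{N}^n$ is $r$-wise $s$-union, then \[ |A|\leq \left|\mathcal{D}(\mathcal{U}(\tilde{\mathbf e}_p,d))\right|. \] Moreover, if equality holds, then $A$ is isomorphic to $\mathcal{D}(\mathcal{U}(\tilde{\mathbf e}_p,d))$.
   Context: $\mathbb{N}=\{0,1,2,\ldots\}$. For $\mathbf a\in\mathbb{N}^n$ the weight is $|\mathbf a|=\sum_{i=1}^n a_i$. The join of $\mathbf a_1,\ldots,\mathbf a_r\in\mathbb{N}^n$ is the vector whose $i$-th component is $\max\{(\mathbf a_1)_i,\ldots,(\mathbf a_r)_i\}$. A family $A\subset\mathbb{N}^n$ is $r$-wise $s$-union if the join of any $r$ vectors $\mathbf a_1,\ldots,\mathbf a_r\in A$ (not necessarily distinct) has weight at most $s$. For $\mathbf a,\mathbf b\in\mathbb{R}^n$ write $\mathbf a\prec\mathbf b$ if $a_i\leq b_i$ for all $i$. For $\mathbf a\in\mathbb{N}^n$, $\mathcal{D}(\mathbf a)=\{\mathbf c\in\mathbb{N}^n:\mathbf c\prec\mathbf a\}$, and for $B\subset\mathbb{N}^n$, $\mathcal{D}(B)=\bigcup_{\mathbf a\in B}\mathcal{D}(\mathbf a)$. For $\mathbf a\in\mathbb{N}^n$ and $d\in\mathbb{N}$, $\mathcal{U}(\mathbf a,d)=\{\mathbf a+\boldsymbol\epsilon:\boldsymbol\epsilon\in\mathbb{N}^n,\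 |\boldsymbol\epsilon|=d\}$. Let $\mathbf e_i$ be the $i$-th standard basis vector of $\mathbb{R}^n$, $\tilde{\mathbf e}_0=\mathbf 0$ and $\tilde{\mathbf e}_i=\sum_{j=1}^i\mathbf e_j$ for $1\leq i\leq n$. Two families in $\mathbb{N}^n$ are isomorphic if one is obtained from the other by a permutation of the coordinates. *)

theory Defs
  imports Complex_Main "HOL-Combinatorics.Permutations"
begin

text \<open>
  The dimension \<open>n\<close> is quantified inside the theorem, so \<open>\<nat>\<^sup>n\<close> is a carrier set rather than a type:
  a vector is a function whose coordinates are indexed by \<open>{1..n}\<close> and which vanishes at all other
  indices, so that equality and \<open>\<le>\<close> of functions are equality and the coordinatewise order of vectors.
\<close>

definition nvecs :: "nat \<Rightarrow> (nat \<Rightarrow> nat) set" where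
  "nvecs n = {a. \<forall>i. i \<notin> {1..n} \<longrightarrow> a i = 0}"

definition weight :: "nat \<Rightarrow> (nat \<Rightarrow> nat) \<Rightarrow> nat" where
  "weight n a = (\<Sum>i=1..n. a i)"

text \<open>Only meaningful for \<open>r \<ge> 1\<close>.\<close>

definition join :: "nat \<Rightarrow> (nat \<Rightarrow> nat \<Rightarrow> nat) \<Rightarrow> nat \<Rightarrow> nat" where
  "join r a = (\<lambda>i. Max ((\<lambda>j. a j i) ` {1..r}))"

definition wise_union :: "nat \<Rightarrow> nat \<Rightarrow> nat \<Rightarrow> (nat \<Rightarrow> nat) set \<Rightarrow> bool" where
  "wise_union n r s A \<longleftrightarrow>
     (\<forall>a. (\<forall>j\<in>{1..r}. a j \<in> A) \<longrightarrow> weight n (join r a) \<le> s)"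

definition down :: "nat \<Rightarrow> (nat \<Rightarrow> nat) \<Rightarrow> (nat \<Rightarrow> nat) set" where
  "down n a = {c \<in> nvecs n. c \<le> a}"

definition down_family :: "nat \<Rightarrow> (nat \<Rightarrow> nat) set \<Rightarrow> (nat \<Rightarrow> nat) set" where
  "down_family n B = (\<Union>a\<in>B. down n a)"

definition up :: "nat \<Rightarrow> (nat \<Rightarrow> nat) \<Rightarrow> nat \<Rightarrow> (nat \<Rightarrow> nat) set" where
  "up n a d = {(\<lambda>i. a i + \<epsilon> i) |\<epsilon>. \<epsilon> \<in> nvecs n \<and> weight n \<epsilon> = d}"

definition unit_vec :: "nat \<Rightarrow> nat \<Rightarrow> nat" where
  "unit_vec j = (\<lambda>k. if k = j then 1 else 0)"

text \<open>Lies in \<^term>\<open>nvecs n\<close> exactly when \<open>i \<le> n\<close>.\<close>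

definition initial_vec :: "nat \<Rightarrow> nat \<Rightarrow> nat" where
  "initial_vec i = (\<lambda>k. \<Sum>j=1..i. unit_vec j k)"

definition isomorphic_families ::
  "nat \<Rightarrow> (nat \<Rightarrow> nat) set \<Rightarrow> (nat \<Rightarrow> nat) set \<Rightarrow> bool" where
  "isomorphic_families n A B \<longleftrightarrow>
     (\<exists>\<pi>. \<pi> permutes {1..n} \<and> B = (\<lambda>a. a \<circ> \<pi>) ` A)"

text \<open>
  The families whose cardinalities are compared are finite, so the convention that \<^const>\<open>card\<close> of an
  infinite set is \<open>0\<close> is never used.
\<close>

lemma finite_bounded_nvecs: "finite {a \<in> nvecs n. \<forall>i\<in>{1..n}. a i \<le> k}"
proof -
  have "finite {f :: nat \<Rightarrow> nat. \<forall>i. (i \<in> {1..n} \<longrightarrow> f i \<in> {..k}) \<and> (i \<notin> {1..n} \<longrightarrow> f i = 0)}"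
    by (rule finite_set_of_finite_funs) auto
  then show ?thesis
    by (rule rev_finite_subset) (auto simp: nvecs_def)
qed

lemma coord_le_weight: "i \<in> {1..n} \<Longrightarrow> a i \<le> weight n a"
  unfolding weight_def by (rule member_le_sum) auto

lemma finite_wise_union:
  assumes "r \<ge> 1" "A \<subseteq> nvecs n" "wise_union n r s A"
  shows "finite A"
proof -
  have "weight n a \<le> s" if "a \<in> A" for a
  proof -
    have "join r (\<lambda>_. a) = a"
      using assms(1) by (auto simp: join_def fun_eq_iff image_constant_conv)
    moreover have "weight n (join r (\<lambda>_. a)) \<le> s"
      using assms(3) that by (auto simp: wise_union_def)
    ultimately show ?thesis by simp
  qed
  then have "A \<subseteq> {a \<in> nvecs n. \<forall>i\<in>{1..n}. a i \<le> s}"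
    using assms(2) coord_le_weight by (blast intro: order_trans)
  then show ?thesis
    using finite_bounded_nvecs finite_subset by blast
qed

lemma finite_down_family_up: "finite (down_family n (up n a d))"
proof -
  define k where "k = weight n a + d"
  have "c i \<le> k" if "c \<in> down_family n (up n a d)" "i \<in> {1..n}" for c i
  proof -
    obtain e where e: "weight n e = d" "c \<le> (\<lambda>i. a i + e i)"
      using \<open>c \<in> _\<close> by (auto simp: down_family_def down_def up_def)
    have "c i \<le> a i + e i" using e(2) by (simp add: le_fun_def)
    also have "\<dots> \<le> k"
      unfolding k_def e(1)[symmetric] using \<open>i \<in> _\<close> by (intro add_mono coord_le_weight)
    finally show ?thesis .
  qed
  then have "down_family n (up n a d) \<subseteq> {a \<in> nvecs n. \<forall>i\<in>{1..n}. a i \<le> k}"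
    unfolding down_family_def down_def by blast
  then show ?thesis
    using finite_bounded_nvecs finite_subset by blast
qed

end

theory Submission
  imports Defs
begin

text \<open>
  Since \<open>s < r (d + 1)\<close>, a greedy choice gives a set \<open>T\<close> of bounded size such that every vector of
  \<open>A\<close> has at most \<open>d\<close> nonzero coordinates outside \<open>T\<close>. Call a pattern \<open>x\<close> on \<open>T\<close> popular if the
  vectors of \<open>A\<close> with restriction \<open>x\<close> and exactly \<open>d\<close> nonzero coordinates outside \<open>T\<close> cannot all be
  hit outside \<open>T\<close> by boundedly many coordinates. All but \<open>O(n\<^sup>d\<^sup>-\<^sup>1)\<close> vectors of \<open>A\<close> have a popular
  pattern and are the indicator of a \<open>d\<close>-set outside \<open>T\<close>. Joining \<open>r\<close> vectors with disjoint
  parts outside \<open>T\<close> shows that any \<open>r\<close> popular patterns have a join of weight at most \<open>p\<close>; as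
  \<open>p < r\<close>, they all lie below one vector \<open>z\<close> of weight at most \<open>p\<close>. So there are at most \<open>2\<^sup>p\<close> of
  them. If there are fewer, \<open>A\<close> is too small by a term of order \<open>n\<^sup>d\<close>. Otherwise \<open>z\<close> is a popular
  0/1 vector of weight \<open>p\<close>, and joining any \<open>a \<in> A\<close> with \<open>r - 1\<close> vectors of pattern \<open>z\<close> shows that
  \<open>a\<close> lies in the copy of the extremal family built on \<open>z\<close>.
\<close>

section \<open>Supports, restrictions and joins\<close>

definition support :: "(nat \<Rightarrow> nat) \<Rightarrow> nat set" where
  "support a = {i. a i \<noteq> 0}"

definition restrict_vec :: "nat set \<Rightarrow> (nat \<Rightarrow> nat) \<Rightarrow> nat \<Rightarrow> nat" where
  "restrict_vec T a = (\<lambda>i. if i \<in> T then a i else 0)"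

lemma support_subset: "a \<in> nvecs n \<Longrightarrow> support a \<subseteq> {1..n}"
  by (auto simp: support_def nvecs_def)

lemma finite_support: "a \<in> nvecs n \<Longrightarrow> finite (support a)"
  using support_subset finite_subset by blast

lemma card_support_le_weight:
  assumes "a \<in> nvecs n"
  shows "card (support a) \<le> weight n a"
proof -
  have "card (support a) = (\<Sum>i\<in>support a. 1)" by simp
  also have "\<dots> \<le> (\<Sum>i\<in>support a. a i)"
    by (intro sum_mono) (auto simp: support_def)
  also have "\<dots> \<le> weight n a"
    unfolding weight_def using support_subset[OF assms] by (intro sum_mono2) auto
  finally show ?thesis .
qed

lemma weight_mono: "(\<And>i. i \<in> {1..n} \<Longrightarrow> a i \<le> b i) \<Longrightarrow> weight n a \<le> weight n b"
  unfolding weight_def by (rule sum_mono)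

lemma join_ge: "j \<in> {1..r} \<Longrightarrow> b j i \<le> join r b i"
  by (simp add: join_def)

lemma wise_unionD:
  "wise_union n r s A \<Longrightarrow> (\<And>j. j \<in> {1..r} \<Longrightarrow> b j \<in> A) \<Longrightarrow> weight n (join r b) \<le> s"
  by (auto simp: wise_union_def)

lemma wise_union_weight_le:
  assumes "r \<ge> 1" "wise_union n r s A" "a \<in> A"
  shows "weight n a \<le> s"
proof -
  have "weight n a \<le> weight n (join r (\<lambda>_. a))"
    using join_ge[of 1 r "\<lambda>_. a"] assms(1) by (intro weight_mono) auto
  also have "\<dots> \<le> s"
    using assms by (intro wise_unionD) auto
  finally show ?thesis .
qed

text \<open>Outside \<open>T\<close> the supports are disjoint, so the join is at least the sum
  there; on \<open>T\<close> it dominates any \<open>x\<close> that is covered coordinate by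
  coordinate. This is how the union condition is exploited once a kernel \<open>T\<close> is
  fixed.\<close>

lemma weight_join_ge:
  assumes T: "T \<subseteq> {1..n}"
    and x: "\<And>i. i \<in> T \<Longrightarrow> \<exists>j\<in>{1..r}. x i \<le> b j i"
    and disj: "\<And>j k. j \<in> {1..r} \<Longrightarrow> k \<in> {1..r} \<Longrightarrow> j \<noteq> k \<Longrightarrow> support (b j) \<inter> support (b k) \<subseteq> T"
  shows "sum x T + (\<Sum>j=1..r. sum (b j) ({1..n} - T)) \<le> weight n (join r b)"
proof -
  have 1: "sum x T \<le> sum (join r b) T"
    using x join_ge by (intro sum_mono) (meson order_trans)
  have "(\<Sum>j=1..r. b j i) \<le> join r b i" if "i \<notin> T" for i
  proof (cases "\<exists>j\<in>{1..r}. b j i \<noteq> 0")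
    case True
    then obtain j where j: "j \<in> {1..r}" "b j i \<noteq> 0" by auto
    have "b k i = 0" if "k \<in> {1..r}" "k \<noteq> j" for k
      using disj[OF that(1) j(1) that(2)] j(2) \<open>i \<notin> T\<close> by (auto simp: support_def)
    then have "(\<Sum>j=1..r. b j i) = b j i"
      using j(1) by (subst sum.remove[of _ j]) auto
    then show ?thesis using join_ge[OF j(1)] by simp
  qed simp
  then have "(\<Sum>i\<in>{1..n} - T. \<Sum>j=1..r. b j i) \<le> sum (join r b) ({1..n} - T)"
    by (intro sum_mono) auto
  then have 2: "(\<Sum>j=1..r. sum (b j) ({1..n} - T)) \<le> sum (join r b) ({1..n} - T)"
    by (subst sum.swap)
  have "weight n (join r b) = sum (join r b) ({1..n} - T) + sum (join r b) T"
    unfolding weight_def using T by (intro sum.subset_diff) auto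
  then show ?thesis using 1 2 by simp
qed

section \<open>Counting vectors\<close>

lemma box_vectors:
  fixes z :: "nat \<Rightarrow> nat"
  assumes "finite V"
  shows "finite {a. (\<forall>i\<in>V. a i \<le> z i) \<and> (\<forall>i. i \<notin> V \<longrightarrow> a i = (0::nat))}" (is "finite ?F")
    and "card {a. (\<forall>i\<in>V. a i \<le> z i) \<and> (\<forall>i. i \<notin> V \<longrightarrow> a i = (0::nat))} \<le> (\<Prod>i\<in>V. z i + 1)"
proof -
  let ?P = "PiE V (\<lambda>i. {..z i})"
  have inj: "inj_on (\<lambda>a. restrict a V) ?F"
  proof (rule inj_onI)
    fix a b assume ab: "a \<in> ?F" "b \<in> ?F" "restrict a V = restrict b V"
    show "a = b"
    proof
      fix i show "a i = b i"
        using ab(1,2) fun_cong[OF ab(3), of i] by (cases "i \<in> V") (simp_all add: restrict_def)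
    qed
  qed
  have sub: "(\<lambda>a. restrict a V) ` ?F \<subseteq> ?P" by auto
  have fin: "finite ?P" using assms by (intro finite_PiE) auto
  show "finite ?F" by (rule finite_imageD[OF finite_subset[OF sub fin] inj])
  have "card ?F \<le> card ?P" using card_inj_on_le[OF inj sub fin] .
  also have "\<dots> = (\<Prod>i\<in>V. z i + 1)" by (subst card_PiE[OF assms]) simp
  finally show "card ?F \<le> (\<Prod>i\<in>V. z i + 1)" .
qed

text \<open>Such a vector is given by a choice of fewer than \<open>d\<close> coordinates outside
  \<open>T\<close> and by bounded values on them and on \<open>T\<close>. For fixed
  \<open>s\<close>, \<open>t\<close>, \<open>d\<close> the count is O(n^(d-1)), an error
  term.\<close>

lemma card_sparse_le:
  assumes "finite T" "card T \<le> t"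
  shows "card {a \<in> nvecs n. (\<forall>i. a i \<le> s) \<and> card (support a - T) < d}
    \<le> (if d = 0 then 0 else (n + 1) ^ (d - 1) * (s + 1) ^ (t + (d - 1)))"
proof (cases d)
  case (Suc e)
  \<comment> \<open>Lists with repetition overcount the sets of at most \<open>e\<close>
    coordinates, which is harmless for an upper bound. The index 0 lies outside
    \<open>{1..n}\<close> and pads short lists to length \<open>e\<close>.\<close>
  define L where "L = {l. set l \<subseteq> {0..n} \<and> length l = e}"
  define F where "F V = {a. (\<forall>i\<in>V. a i \<le> s) \<and> (\<forall>i. i \<notin> V \<longrightarrow> a i = (0::nat))}" for V :: "nat set"
  have finL: "finite L" unfolding L_def by (rule finite_lists_length_eq) simp
  have cardL: "card L = (n + 1) ^ e"
    unfolding L_def by (subst card_lists_length_eq) auto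
  have finF: "finite (F (T \<union> set l))" for l
    unfolding F_def using box_vectors(1)[of "T \<union> set l" "\<lambda>_. s"] assms(1) by simp
  have cardF: "card (F (T \<union> set l)) \<le> (s + 1) ^ (t + e)" if "l \<in> L" for l
  proof -
    have "card (F (T \<union> set l)) \<le> (s + 1) ^ card (T \<union> set l)"
      unfolding F_def using box_vectors(2)[of "T \<union> set l" "\<lambda>_. s"] assms(1) by simp
    also have "card (T \<union> set l) \<le> t + e"
      using card_Un_le[of T "set l"] card_length[of l] that assms(2) by (auto simp: L_def)
    then have "(s + 1) ^ card (T \<union> set l) \<le> (s + 1) ^ (t + e)"
      by (intro power_increasing) auto
    finally show ?thesis .
  qed
  have "{a \<in> nvecs n. (\<forall>i. a i \<le> s) \<and> card (support a - T) < d} \<subseteq> (\<Union>l\<in>L. F (T \<union> set l))"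
  proof
    fix a assume a: "a \<in> {a \<in> nvecs n. (\<forall>i. a i \<le> s) \<and> card (support a - T) < d}"
    then have sup: "support a - T \<subseteq> {0..n}" "finite (support a - T)" "card (support a - T) \<le> e"
      using support_subset[of a n] finite_support[of a n] Suc by auto
    define l0 where "l0 = sorted_list_of_set (support a - T)"
    define l where "l = l0 @ replicate (e - length l0) 0"
    have "set l0 = support a - T" "length l0 \<le> e"
      using sup by (simp_all add: l0_def)
    then have "l \<in> L" "support a - T \<subseteq> set l"
      using sup by (auto simp: l_def L_def)
    moreover from this have "a \<in> F (T \<union> set l)"
      using a by (auto simp: F_def support_def)
    ultimately show "a \<in> (\<Union>l\<in>L. F (T \<union> set l))" by blast
  qed
  then have "card {a \<in> nvecs n. (\<forall>i. a i \<le> s) \<and> card (support a - T) < d} \<le> card (\<Union>l\<in>L. F (T \<union> set l))"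
    using finL finF by (intro card_mono) auto
  also have "\<dots> \<le> (\<Sum>l\<in>L. card (F (T \<union> set l)))" using finL by (rule card_UN_le)
  also have "\<dots> \<le> (\<Sum>l\<in>L. (s + 1) ^ (t + e))" using cardF by (rule sum_mono)
  also have "\<dots> = (n + 1) ^ e * (s + 1) ^ (t + e)" using cardL by simp
  finally show ?thesis using Suc by simp
qed simp

text \<open>Each factor satisfies k + 1 \<le> 2^k. The product is the number of vectors supported on
  \<open>T\<close> that lie below \<open>z\<close>.\<close>

lemma prod_Suc_le_power_sum:
  fixes z :: "nat \<Rightarrow> nat"
  assumes "finite T"
  shows "(\<Prod>i\<in>T. z i + 1) \<le> 2 ^ sum z T"
  unfolding power_sum by (rule prod_mono) (simp add: Suc_le_eq)

text \<open>Since k + 1 < 2^k from k = 2 on, one coordinate above 1 makes the bound strict. This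
  later forces \<open>z\<close> to be a 0/1 vector.\<close>

lemma prod_Suc_less_power_sum:
  fixes z :: "nat \<Rightarrow> nat"
  assumes "finite T" "i \<in> T" "z i \<ge> 2"
  shows "(\<Prod>i\<in>T. z i + 1) < 2 ^ sum z T"
proof -
  have *: "k + 1 < 2 ^ k" if "k \<ge> 2" for k :: nat
    using that by (induction k rule: dec_induct) auto
  have "(\<Prod>i\<in>T. z i + 1) = (z i + 1) * (\<Prod>i\<in>T - {i}. z i + 1)"
    using assms by (simp add: prod.remove)
  also have "\<dots> \<le> (z i + 1) * 2 ^ sum z (T - {i})"
    using assms prod_Suc_le_power_sum[of "T - {i}" z] by (intro mult_left_mono) auto
  also have "\<dots> < 2 ^ z i * 2 ^ sum z (T - {i})"
    using *[OF assms(3)] by (intro mult_strict_right_mono) auto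
  also have "\<dots> = 2 ^ sum z T"
    using assms by (simp add: sum.remove[of T i] power_add)
  finally show ?thesis .
qed

section \<open>Structure of large families\<close>

text \<open>Otherwise \<open>r\<close> members of \<open>A\<close> can be picked in turn, each with
  at least d + 1 nonzero coordinates outside the earlier supports. Their join then has at least r(d
  + 1) > s nonzero coordinates.\<close>

lemma exists_kernel:
  assumes r: "r \<ge> 1" and A: "A \<subseteq> nvecs n" "wise_union n r s A" and s: "s < r * (d + 1)"
  obtains T where "T \<subseteq> {1..n}" "card T \<le> r * s" "\<And>a. a \<in> A \<Longrightarrow> card (support a - T) \<le> d"
proof (rule ccontr)
  note that' = that
  assume "\<not> thesis"
  \<comment> \<open>The bound \<open>r * s\<close> is chosen so that the union of the supports
    picked so far is always a candidate for \<open>T\<close>.\<close>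
  have no: "\<exists>a\<in>A. card (support a - T) > d" if "T \<subseteq> {1..n}" "card T \<le> r * s" for T
  proof (rule ccontr)
    assume "\<not> (\<exists>a\<in>A. card (support a - T) > d)"
    then have thesis by (intro that'[OF \<open>T \<subseteq> {1..n}\<close> \<open>card T \<le> r * s\<close>]) (simp add: not_less)
    then show False using \<open>\<not> thesis\<close> by contradiction
  qed
  have supp: "support a \<subseteq> {1..n}" "finite (support a)" "card (support a) \<le> s" if "a \<in> A" for a
  proof -
    have "a \<in> nvecs n" using that A(1) by blast
    then show "support a \<subseteq> {1..n}" "finite (support a)" "card (support a) \<le> s"
      using support_subset finite_support card_support_le_weight[of a n]
        wise_union_weight_le[OF r A(2) that] by auto
  qed
  have "\<exists>b. (\<forall>j\<in>{1..m}. b j \<in> A) \<and> card (\<Union>j\<in>{1..m}. support (b j)) \<ge> m * (d + 1)"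
    if "m \<le> r" for m
    using that
  proof (induction m)
    case (Suc m)
    then obtain b where b: "\<forall>j\<in>{1..m}. b j \<in> A"
      "card (\<Union>j\<in>{1..m}. support (b j)) \<ge> m * (d + 1)" by auto
    define U where "U = (\<Union>j\<in>{1..m}. support (b j))"
    have "card U \<le> (\<Sum>j\<in>{1..m}. card (support (b j)))"
      unfolding U_def by (rule card_UN_le) simp
    also have "\<dots> \<le> (\<Sum>j\<in>{1..m}. s)" using b(1) supp(3) by (intro sum_mono) auto
    also have "\<dots> \<le> r * s" using Suc.prems by simp
    finally have "card U \<le> r * s" .
    moreover have U: "U \<subseteq> {1..n}" using b(1) supp(1) unfolding U_def by blast
    ultimately obtain a where a: "a \<in> A" "card (support a - U) > d" using no by blast
    define b' where "b' = b(Suc m := a)"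
    have "(\<Union>j\<in>{1..Suc m}. support (b' j)) = U \<union> (support a - U)"
      unfolding U_def b'_def by (auto simp: atLeastAtMostSuc_conv)
    moreover have "card (U \<union> (support a - U)) = card U + card (support a - U)"
      using U supp(2)[OF a(1)] by (intro card_Un_disjoint) (auto intro: finite_subset)
    ultimately have "card (\<Union>j\<in>{1..Suc m}. support (b' j)) \<ge> Suc m * (d + 1)"
      using a(2) b(2) unfolding U_def by simp
    moreover have "\<forall>j\<in>{1..Suc m}. b' j \<in> A" using b(1) a(1) by (auto simp: b'_def)
    ultimately show ?case by blast
  qed auto
  then obtain b where b: "\<forall>j\<in>{1..r}. b j \<in> A"
    "card (\<Union>j\<in>{1..r}. support (b j)) \<ge> r * (d + 1)" by blast
  define U where "U = (\<Union>j\<in>{1..r}. support (b j))"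
  have "card U = (\<Sum>i\<in>U. 1)" by simp
  also have "\<dots> \<le> sum (join r b) U"
  proof (rule sum_mono)
    fix i assume "i \<in> U"
    then obtain j where "j \<in> {1..r}" "b j i \<noteq> 0" by (auto simp: U_def support_def)
    then show "1 \<le> join r b i" using join_ge[of j r b i] by simp
  qed
  also have "\<dots> \<le> weight n (join r b)"
    unfolding weight_def using b(1) supp(1) unfolding U_def by (intro sum_mono2) blast+
  also have "\<dots> \<le> s" using A(2) b(1) by (intro wise_unionD) auto
  finally show False using b(2) s unfolding U_def by simp
qed

text \<open>At each step \<open>H\<close> is the union of the supports already chosen. The
  prescribed start \<open>a0\<close> need not belong to \<open>A\<close>.\<close>

lemma greedy_disjoint_choice:
  assumes A: "\<And>a. a \<in> A \<Longrightarrow> finite (support a) \<and> card (support a) \<le> s"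
    and a0: "finite (support a0)" "card (support a0) \<le> s"
    and Q: "\<And>j H. j \<in> {1..m} \<Longrightarrow> finite H \<Longrightarrow> card H \<le> m * s \<Longrightarrow>
      \<exists>a\<in>A. Q j a \<and> support a \<inter> H \<subseteq> T"
  obtains b where "b 0 = a0" "\<And>j. j \<in> {1..m} \<Longrightarrow> b j \<in> A \<and> Q j (b j)"
    "\<And>j k. j \<le> m \<Longrightarrow> k \<le> m \<Longrightarrow> j \<noteq> k \<Longrightarrow> support (b j) \<inter> support (b k) \<subseteq> T"
proof -
  have "\<exists>b. b 0 = a0 \<and> (\<forall>j\<in>{1..l}. b j \<in> A \<and> Q j (b j)) \<and>
    (\<forall>j\<le>l. \<forall>k\<le>l. j \<noteq> k \<longrightarrow> support (b j) \<inter> support (b k) \<subseteq> T)" if "l \<le> m" for l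
    using that
  proof (induction l)
    case 0
    then show ?case by auto
  next
    case (Suc l)
    then obtain b where b: "b 0 = a0" "\<forall>j\<in>{1..l}. b j \<in> A \<and> Q j (b j)"
      "\<forall>j\<le>l. \<forall>k\<le>l. j \<noteq> k \<longrightarrow> support (b j) \<inter> support (b k) \<subseteq> T" by auto
    have bs: "finite (support (b j)) \<and> card (support (b j)) \<le> s" if "j \<le> l" for j
      using that b(1,2) a0 A by (cases "j = 0") auto
    define U where "U = (\<Union>j\<in>{..l}. support (b j))"
    have "card U \<le> (\<Sum>j\<in>{..l}. card (support (b j)))"
      unfolding U_def by (rule card_UN_le) simp
    also have "\<dots> \<le> (\<Sum>j\<in>{..l}. s)" using bs by (intro sum_mono) auto
    \<comment> \<open>The support of \<open>a0\<close> at index 0 counts as well, and l + 1 \<le> m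
      because one more vector is still to be chosen.\<close>
    also have "\<dots> = Suc l * s" by simp
    also have "\<dots> \<le> m * s" using Suc.prems by (rule mult_right_mono) simp
    finally have "card U \<le> m * s" .
    moreover have "finite U" using bs by (auto simp: U_def)
    moreover have "Suc l \<in> {1..m}" using Suc.prems by simp
    ultimately obtain a where a: "a \<in> A" "Q (Suc l) a" "support a \<inter> U \<subseteq> T" using Q by blast
    have new: "support a \<inter> support (b j) \<subseteq> T" if "j \<le> l" for j
      using a(3) that by (auto simp: U_def)
    define b' where "b' = b(Suc l := a)"
    have "support (b' j) \<inter> support (b' k) \<subseteq> T" if "j \<le> Suc l" "k \<le> Suc l" "j \<noteq> k" for j k
    proof -
      consider "j = Suc l" "k \<le> l" | "k = Suc l" "j \<le> l" | "j \<le> l" "k \<le> l"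
        using \<open>j \<le> Suc l\<close> \<open>k \<le> Suc l\<close> \<open>j \<noteq> k\<close> by linarith
      then show ?thesis
        using new b(3) \<open>j \<noteq> k\<close> by cases (auto simp: b'_def)
    qed
    moreover have "b' 0 = a0" "\<forall>j\<in>{1..Suc l}. b' j \<in> A \<and> Q j (b' j)"
      using a(1,2) b(1,2) by (auto simp: b'_def)
    ultimately show ?case by blast
  qed
  from this[OF order_refl] show ?thesis using that by blast
qed

text \<open>Start from 0 and raise \<open>z\<close> whenever a member of \<open>X\<close> exceeds it
  somewhere; each raise uses one member and adds at least 1 to the weight. If \<open>z\<close> were
  still no upper bound after \<open>r\<close> rounds, its weight would be at least r > p, against
  the hypothesis.\<close>

lemma common_upper_bound:
  fixes X :: "(nat \<Rightarrow> nat) set"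
  assumes X: "\<And>b z. (\<And>j. j \<in> {1..r} \<Longrightarrow> b j \<in> X) \<Longrightarrow>
      (\<And>i. i \<in> T \<Longrightarrow> \<exists>j\<in>{1..r}. z i \<le> b j i) \<Longrightarrow> sum z T \<le> p"
    and "finite T" "p < r"
  obtains z where "\<And>x i. x \<in> X \<Longrightarrow> i \<in> T \<Longrightarrow> x i \<le> z i" "sum z T \<le> p"
proof (cases "X = {}")
  case True
  then show ?thesis using that[of "\<lambda>_. 0"] by auto
next
  case False
  \<comment> \<open>\<open>z\<close> stays below the join of the \<open>b j\<close>; the alternative
    \<open>z i = 0\<close> covers the start, when there is no \<open>b j\<close> yet.\<close>
  have "\<exists>b z. (\<forall>j\<in>{1..m}. b j \<in> X) \<and> (\<forall>i\<in>T. z i = 0 \<or> (\<exists>j\<in>{1..m}. z i \<le> b j i)) \<and>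
     (m \<le> sum z T \<or> (\<forall>x\<in>X. \<forall>i\<in>T. x i \<le> z i))" for m
  proof (induction m)
    case 0
    show ?case by (rule exI, rule exI[of _ "\<lambda>_. 0"]) auto
  next
    case (Suc m)
    then obtain b z where bz: "\<forall>j\<in>{1..m}. b j \<in> X"
      "\<forall>i\<in>T. z i = 0 \<or> (\<exists>j\<in>{1..m}. z i \<le> b j i)"
      "m \<le> sum z T \<or> (\<forall>x\<in>X. \<forall>i\<in>T. x i \<le> z i)" by blast
    show ?case
    proof (cases "\<forall>x\<in>X. \<forall>i\<in>T. x i \<le> z i")
      case True
      \<comment> \<open>Once \<open>z\<close> is an upper bound, any member of \<open>X\<close>
        fills the next place, because the hypothesis speaks of exactly \<open>r\<close>
        vectors.\<close>
      obtain x where "x \<in> X" using False by blast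
      define b' where "b' = b(Suc m := x)"
      have b'b: "b' j = b j" if "j \<in> {1..m}" for j using that by (simp add: b'_def)
      have "\<forall>j\<in>{1..Suc m}. b' j \<in> X" using bz(1) \<open>x \<in> X\<close> by (auto simp: b'_def)
      moreover have "\<exists>j\<in>{1..Suc m}. z i \<le> b' j i" if "\<exists>j\<in>{1..m}. z i \<le> b j i" for i
      proof -
        from that obtain j where "j \<in> {1..m}" "z i \<le> b j i" by blast
        then show ?thesis using b'b by (intro bexI[of _ j]) auto
      qed
      ultimately show ?thesis
        using bz(2) True by (intro exI[of _ b'] exI[of _ z] conjI ballI) blast+
    next
      case False
      then obtain x i where x: "x \<in> X" "i \<in> T" "x i > z i" by (auto simp: not_le)
      define b' where "b' = b(Suc m := x)"
      \<comment> \<open>Only coordinate \<open>i\<close> is raised, to the value that the new member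
        \<open>x\<close> attains there, so \<open>z'\<close> is still covered.\<close>
      define z' where "z' = z(i := x i)"
      have b'b: "b' j = b j" if "j \<in> {1..m}" for j using that by (simp add: b'_def)
      have b'X: "\<forall>j\<in>{1..Suc m}. b' j \<in> X" using bz(1) x(1) by (auto simp: b'_def)
      have z'b: "z' k = 0 \<or> (\<exists>j\<in>{1..Suc m}. z' k \<le> b' j k)" if k: "k \<in> T" for k
      proof (cases "k = i")
        case True
        then show ?thesis by (auto simp: z'_def b'_def)
      next
        case False
        then have z'k: "z' k = z k" by (simp add: z'_def)
        show ?thesis
        proof (cases "z k = 0")
          case False
          with bspec[OF bz(2) k] obtain j where "j \<in> {1..m}" "z k \<le> b j k" by auto
          then show ?thesis using b'b z'k by (intro disjI2 bexI[of _ j]) auto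
        qed (simp add: z'k)
      qed
      have "sum z T < sum z' T"
      proof (rule sum_strict_mono_ex1[OF \<open>finite T\<close>])
        show "\<forall>k\<in>T. z k \<le> z' k" using x(3) by (simp add: z'_def)
        show "\<exists>k\<in>T. z k < z' k" using x(2,3) by (intro bexI[of _ i]) (simp_all add: z'_def)
      qed
      then have "Suc m \<le> sum z' T" using bz(3) False by auto
      then show ?thesis
        using b'X by (intro exI[of _ b'] exI[of _ z'] conjI ballI z'b disjI1) auto
    qed
  qed
  from this[of r] obtain b z where bz: "\<forall>j\<in>{1..r}. b j \<in> X"
    "\<forall>i\<in>T. z i = 0 \<or> (\<exists>j\<in>{1..r}. z i \<le> b j i)"
    "r \<le> sum z T \<or> (\<forall>x\<in>X. \<forall>i\<in>T. x i \<le> z i)" by (elim exE conjE) (rule that)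
  have zb: "\<exists>j\<in>{1..r}. z i \<le> b j i" if "i \<in> T" for i
  proof (cases "z i = 0")
    case True
    then show ?thesis using \<open>p < r\<close> by (intro bexI[of _ 1]) auto
  qed (use bspec[OF bz(2) that] in simp)
  have "sum z T \<le> p" by (rule X[OF bspec[OF bz(1)] zb])
  moreover from this have "\<forall>x\<in>X. \<forall>i\<in>T. x i \<le> z i" using bz(3) \<open>p < r\<close> by simp
  ultimately show ?thesis by (intro that[of z]) simp_all
qed

text \<open>
  The bound \<open>t'\<close> is the size of \<open>T\<close> enlarged by one hitting set for each unpopular pattern. A pattern
  records, besides the restriction to \<open>T\<close>, whether the weight outside \<open>T\<close> exceeds \<open>d\<close>; hence the
  factor 2.
\<close>

lemma large_family_structure:
  assumes r: "r \<ge> 2" and s: "s = d * r + p" and p: "p < r"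
    and A: "A \<subseteq> nvecs n" "wise_union n r s A"
  defines "t' \<equiv> r * s + 2 * (s + 1) ^ (r * s) * (r * s)"
  shows "card A \<le> (2 ^ p - 1) * (n choose d)
             + (if d = 0 then 0 else (n + 1) ^ (d - 1) * (s + 1) ^ (t' + (d - 1))) \<or>
         (\<exists>z\<in>nvecs n. (\<forall>i. z i \<le> 1) \<and> weight n z = p \<and>
            (\<forall>a\<in>A. weight n (\<lambda>i. max (a i) (z i)) \<le> p + d))"
proof -
  have r1: "r \<ge> 1" and s_less: "s < r * (d + 1)" using r s p by (auto simp: algebra_simps)
  have supp: "support a \<subseteq> {1..n}" "finite (support a)" "card (support a) \<le> s" "weight n a \<le> s"
    if "a \<in> A" for a
  proof -
    have "a \<in> nvecs n" using that A(1) by blast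
    then show "support a \<subseteq> {1..n}" "finite (support a)" "card (support a) \<le> s" "weight n a \<le> s"
      using support_subset finite_support card_support_le_weight[of a n]
        wise_union_weight_le[OF r1 A(2) that] by auto
  qed
  have le_s: "a i \<le> s" if "a \<in> A" for a i
  proof (cases "i \<in> {1..n}")
    case True
    then show ?thesis using coord_le_weight[OF True, of a] supp(4)[OF that] by simp
  next
    case False
    then have "i \<notin> support a" using supp(1)[OF that] by blast
    then show ?thesis by (simp add: support_def)
  qed
  obtain T where T: "T \<subseteq> {1..n}" "card T \<le> r * s"
    and Td: "\<And>a. a \<in> A \<Longrightarrow> card (support a - T) \<le> d"
    using exists_kernel[OF r1 A s_less] by blast
  have finT: "finite T" using T(1) finite_subset by blast

  define out where "out a = sum a ({1..n} - T)" for a :: "nat \<Rightarrow> nat"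
  define G where "G = {a \<in> A. card (support a - T) = d}"
  define kind where "kind a = (restrict_vec T a, d < out a)" for a
  have kindD: "x i = a i" if "kind a = (x, h)" "i \<in> T" for x a h i
    using that by (auto simp: kind_def restrict_vec_def)
  define K where "K = kind ` A"
  \<comment> \<open>A popular kind has members avoiding, outside \<open>T\<close>, any
    \<open>r * s\<close> given coordinates; this many suffice to cover the supports of
    \<open>r\<close> members of \<open>A\<close>.\<close>
  define popular where "popular \<kappa> \<longleftrightarrow>
    (\<forall>H. finite H \<and> card H \<le> r * s \<longrightarrow> (\<exists>a\<in>G. kind a = \<kappa> \<and> support a \<inter> H \<subseteq> T))" for \<kappa>

  have out_sum: "out a = sum a (support a - T)" if "a \<in> A" for a
    unfolding out_def using supp(1)[OF that]
    by (intro sum.mono_neutral_right) (auto simp: support_def)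
  have out_ge: "d \<le> out a" if "a \<in> G" for a
  proof -
    have "d = (\<Sum>i\<in>support a - T. 1)" using that by (simp add: G_def)
    also have "\<dots> \<le> sum a (support a - T)" by (rule sum_mono) (auto simp: support_def)
    also have "\<dots> = out a" using that by (simp add: out_sum G_def)
    finally show ?thesis .
  qed

  define B where "B = {a. (\<forall>i\<in>T. a i \<le> s) \<and> (\<forall>i. i \<notin> T \<longrightarrow> a i = (0::nat))}"
  have B: "finite B" "card B \<le> (s + 1) ^ (r * s)"
  proof -
    show "finite B" unfolding B_def by (rule box_vectors(1)[OF finT])
    have "card B \<le> (s + 1) ^ card T"
      using box_vectors(2)[OF finT, of "\<lambda>_. s"] by (simp add: B_def)
    also have "\<dots> \<le> (s + 1) ^ (r * s)" using T(2) by (intro power_increasing) auto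
    finally show "card B \<le> (s + 1) ^ (r * s)" .
  qed
  have KB: "K \<subseteq> B \<times> UNIV"
    using le_s by (auto simp: K_def kind_def B_def restrict_vec_def)
  have finK: "finite K" using KB B(1) by (auto intro: finite_subset)
  have "card K \<le> card (B \<times> (UNIV :: bool set))" using KB B(1) by (intro card_mono) auto
  then have cardK: "card K \<le> 2 * (s + 1) ^ (r * s)" using B(2) by (simp add: card_cartesian_product)

  have "\<exists>H. \<not> popular \<kappa> \<longrightarrow>
      finite H \<and> card H \<le> r * s \<and> (\<forall>a\<in>G. kind a = \<kappa> \<longrightarrow> \<not> support a \<inter> H \<subseteq> T)" for \<kappa>
  proof (cases "popular \<kappa>")
    case False
    then obtain H where "finite H" "card H \<le> r * s"
      "\<not> (\<exists>a\<in>G. kind a = \<kappa> \<and> support a \<inter> H \<subseteq> T)"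
      unfolding popular_def not_all not_imp by (elim exE conjE) (rule that)
    then show ?thesis by (intro exI[of _ H] impI conjI ballI notI) auto
  qed simp
  then obtain H where H: "\<And>\<kappa>. \<not> popular \<kappa> \<Longrightarrow> finite (H \<kappa>)"
    "\<And>\<kappa>. \<not> popular \<kappa> \<Longrightarrow> card (H \<kappa>) \<le> r * s"
    "\<And>\<kappa> a. \<not> popular \<kappa> \<Longrightarrow> a \<in> G \<Longrightarrow> kind a = \<kappa> \<Longrightarrow> \<not> support a \<inter> H \<kappa> \<subseteq> T"
    by metis
  define R where "R = {\<kappa> \<in> K. \<not> popular \<kappa>}"
  \<comment> \<open>A member of \<open>G\<close> of unpopular kind has a nonzero coordinate outside
    \<open>T\<close> in the hitting set of its kind. It therefore has fewer than \<open>d\<close>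
    nonzero coordinates outside \<open>T'\<close>.\<close>
  define T' where "T' = T \<union> (\<Union>\<kappa>\<in>R. H \<kappa>)"
  have finR: "finite R" using finK by (simp add: R_def)
  have finT': "finite T'" using finT finR H(1) by (auto simp: T'_def R_def)
  have cardT': "card T' \<le> t'"
  proof -
    have "card (\<Union>\<kappa>\<in>R. H \<kappa>) \<le> (\<Sum>\<kappa>\<in>R. card (H \<kappa>))" using finR by (rule card_UN_le)
    also have "\<dots> \<le> (\<Sum>\<kappa>\<in>R. r * s)" using H(2) by (intro sum_mono) (simp add: R_def)
    also have "\<dots> = card R * (r * s)" by simp
    also have "\<dots> \<le> card K * (r * s)"
      using finK by (intro mult_right_mono card_mono) (auto simp: R_def)
    also have "\<dots> \<le> 2 * (s + 1) ^ (r * s) * (r * s)" using cardK by (intro mult_right_mono) auto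
    finally show ?thesis
      using card_Un_le[of T "\<Union>\<kappa>\<in>R. H \<kappa>"] T(2) unfolding T'_def t'_def by linarith
  qed

  \<comment> \<open>\<open>b 0\<close> is a free slot: a dummy zero vector when \<open>r\<close>
    popular kinds are joined, an arbitrary member of \<open>A\<close> when \<open>r - 1\<close>
    are.\<close>
  have choice: "\<exists>b. b 0 = a0 \<and> (\<forall>j\<in>{1..m}. b j \<in> G \<and> kind (b j) = \<kappa> j) \<and>
      (\<forall>j\<le>m. \<forall>k\<le>m. j \<noteq> k \<longrightarrow> support (b j) \<inter> support (b k) \<subseteq> T)"
    if pop: "\<And>j. j \<in> {1..m} \<Longrightarrow> popular (\<kappa> j)" and "m \<le> r"
      and a0: "finite (support a0)" "card (support a0) \<le> s"
    for m \<kappa> a0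
  proof -
    have "\<exists>a\<in>A. (a \<in> G \<and> kind a = \<kappa> j) \<and> support a \<inter> H \<subseteq> T"
      if jH: "j \<in> {1..m}" "finite H" "card H \<le> m * s" for j H
    proof -
      have "m * s \<le> r * s" using \<open>m \<le> r\<close> by (rule mult_right_mono) simp
      then have "card H \<le> r * s" using jH(3) by linarith
      then obtain a where "a \<in> G" "kind a = \<kappa> j" "support a \<inter> H \<subseteq> T"
        using pop[OF jH(1)] jH(2) unfolding popular_def by auto
      then show ?thesis by (auto simp: G_def)
    qed
    note avoid = this
    show ?thesis
    proof (rule greedy_disjoint_choice[of A s a0 m "\<lambda>j a. a \<in> G \<and> kind a = \<kappa> j" T, OF _ a0 avoid])
      show "finite (support a) \<and> card (support a) \<le> s" if "a \<in> A" for a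
        using supp(2,3)[OF that] by simp
      show ?thesis
        if "b 0 = a0" "\<And>j. j \<in> {1..m} \<Longrightarrow> b j \<in> A \<and> (b j \<in> G \<and> kind (b j) = \<kappa> j)"
          "\<And>j k. j \<le> m \<Longrightarrow> k \<le> m \<Longrightarrow> j \<noteq> k \<Longrightarrow> support (b j) \<inter> support (b k) \<subseteq> T" for b
        using that by (intro exI[of _ b]) simp
    qed
  qed

  have join_bound: "sum x T + (\<Sum>j=1..r. out (b j)) \<le> s"
    if "\<And>j. j \<in> {1..r} \<Longrightarrow> b j \<in> A" "\<And>i. i \<in> T \<Longrightarrow> \<exists>j\<in>{1..r}. x i \<le> b j i"
      "\<And>j k. j \<in> {1..r} \<Longrightarrow> k \<in> {1..r} \<Longrightarrow> j \<noteq> k \<Longrightarrow> support (b j) \<inter> support (b k) \<subseteq> T"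
    for x b
    using weight_join_ge[OF T(1), of r x b, OF that(2,3)] wise_unionD[OF A(2), of b, OF that(1)]
    unfolding out_def by linarith

  \<comment> \<open>\<open>r\<close> members with disjoint outer parts of weight at least d + 1
    would have a join of weight at least r(d + 1) > s.\<close>
  have light: "\<not> popular (x, True)" for x
  proof
    assume pop: "popular (x, True)"
    have "\<exists>b. b 0 = (\<lambda>_. 0) \<and> (\<forall>j\<in>{1..r}. b j \<in> G \<and> kind (b j) = (x, True)) \<and>
      (\<forall>j\<le>r. \<forall>k\<le>r. j \<noteq> k \<longrightarrow> support (b j) \<inter> support (b k) \<subseteq> T)"
      using pop by (intro choice) (auto simp: support_def)
    then obtain b where b: "\<forall>j\<in>{1..r}. b j \<in> G \<and> kind (b j) = (x, True)"
      "\<forall>j\<le>r. \<forall>k\<le>r. j \<noteq> k \<longrightarrow> support (b j) \<inter> support (b k) \<subseteq> T" by blast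
    have "sum (\<lambda>_. 0) T + (\<Sum>j=1..r. out (b j)) \<le> s"
      using b r1 by (intro join_bound) (auto simp: G_def intro!: bexI[of _ 1])
    moreover have "(\<Sum>j=1..r. d + 1) \<le> (\<Sum>j=1..r. out (b j))"
      using b(1) by (intro sum_mono) (simp add: kind_def Suc_le_eq)
    ultimately show False using s_less by simp
  qed

  define X where "X = {x. popular (x, False)}"
  have XT: "x i = 0" if "x \<in> X" "i \<notin> T" for x i
  proof -
    have "\<exists>a\<in>G. kind a = (x, False) \<and> support a \<inter> {} \<subseteq> T"
      using that(1) unfolding X_def popular_def mem_Collect_eq by (elim allE[of _ "{}"]) simp
    then show ?thesis using that(2) by (auto simp: kind_def restrict_vec_def)
  qed
  \<comment> \<open>Realise \<open>r\<close> popular patterns by members with disjoint outer parts.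
    These parts use weight at least d r, which leaves at most s - d r = p for the join of the
    patterns.\<close>
  obtain z where z: "\<And>x i. x \<in> X \<Longrightarrow> i \<in> T \<Longrightarrow> x i \<le> z i" "sum z T \<le> p"
  proof (rule common_upper_bound[of r X T p])
    fix x y
    assume x: "\<And>j. j \<in> {1..r} \<Longrightarrow> x j \<in> X" and y: "\<And>i. i \<in> T \<Longrightarrow> \<exists>j\<in>{1..r}. y i \<le> x j i"
    have "\<exists>b. b 0 = (\<lambda>_. 0) \<and> (\<forall>j\<in>{1..r}. b j \<in> G \<and> kind (b j) = (x j, False)) \<and>
      (\<forall>j\<le>r. \<forall>k\<le>r. j \<noteq> k \<longrightarrow> support (b j) \<inter> support (b k) \<subseteq> T)"
      using x by (intro choice) (auto simp: support_def X_def)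
    then obtain b where b: "\<forall>j\<in>{1..r}. b j \<in> G \<and> kind (b j) = (x j, False)"
      "\<forall>j\<le>r. \<forall>k\<le>r. j \<noteq> k \<longrightarrow> support (b j) \<inter> support (b k) \<subseteq> T" by blast
    have xb: "x j i = b j i" if "j \<in> {1..r}" "i \<in> T" for i j
      using b(1) that kindD[of "b j" "x j" False i] by blast
    have "sum y T + (\<Sum>j=1..r. out (b j)) \<le> s"
    proof (rule join_bound)
      show "\<exists>j\<in>{1..r}. y i \<le> b j i" if "i \<in> T" for i
        using y[OF that] xb that by auto
    qed (use b in \<open>auto simp: G_def\<close>)
    moreover have "(\<Sum>j=1..r. d) \<le> (\<Sum>j=1..r. out (b j))"
      using b(1) out_ge by (intro sum_mono) auto
    ultimately show "sum y T \<le> p" using s by (simp add: mult.commute)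
  qed (use finT p in auto)

  define Z where "Z = {a. (\<forall>i\<in>T. a i \<le> z i) \<and> (\<forall>i. i \<notin> T \<longrightarrow> a i = (0::nat))}"
  have Z: "finite Z" "card Z \<le> (\<Prod>i\<in>T. z i + 1)"
    unfolding Z_def using box_vectors[OF finT] by auto
  have XZ: "X \<subseteq> Z" using z(1) XT by (auto simp: Z_def)
  then have finX: "finite X" using Z(1) finite_subset by blast
  have cardX: "card X \<le> (\<Prod>i\<in>T. z i + 1)" using card_mono[OF Z(1) XZ] Z(2) by simp
  have pow_le: "(2::nat) ^ sum z T \<le> 2 ^ p" using z(2) by (intro power_increasing) auto

  \<comment> \<open>\<open>N\<close> carries the leading term of order n^d; the rest of
    \<open>A\<close> lies in the sparse set \<open>S\<close>.\<close>
  define N where "N = {a \<in> A. card (support a - T') = d}"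
  define S where "S = {a \<in> nvecs n. (\<forall>i. a i \<le> s) \<and> card (support a - T') < d}"
  have N: "a \<in> G \<and> support a - T' = support a - T \<and> restrict_vec T a \<in> X \<and> out a = d"
    if "a \<in> N" for a
  proof -
    have a: "a \<in> A" "card (support a - T') = d" using that by (auto simp: N_def)
    have sub: "support a - T' \<subseteq> support a - T" by (auto simp: T'_def)
    \<comment> \<open>\<open>d\<close> nonzero coordinates lie outside \<open>T'\<close> and at most
      \<open>d\<close> outside \<open>T\<close>, so the enlargement of \<open>T\<close> removed none
      of them.\<close>
    have eq: "support a - T' = support a - T"
      using sub a Td[OF a(1)] supp(2)[OF a(1)] by (intro card_seteq) auto
    then have aG: "a \<in> G" using a by (simp add: G_def)
    have pop: "popular (kind a)"
    proof (rule ccontr)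
      assume np: "\<not> popular (kind a)"
      then have "H (kind a) \<subseteq> T'" using a(1) by (auto simp: T'_def R_def K_def)
      then have "support a \<inter> H (kind a) \<subseteq> T" using eq by blast
      then show False using H(3)[OF np aG refl] by blast
    qed
    then have "\<not> d < out a" using light unfolding kind_def by (cases "d < out a") auto
    then show ?thesis
      using pop eq aG out_ge[OF aG] by (auto simp: X_def kind_def)
  qed
  have "card N \<le> card (X \<times> {D. D \<subseteq> {1..n} \<and> card D = d})"
  proof (rule card_inj_on_le)
    show "inj_on (\<lambda>a. (restrict_vec T a, support a - T)) N"
    proof (rule inj_onI)
      fix a b
      assume ab: "a \<in> N" "b \<in> N"
        "(restrict_vec T a, support a - T) = (restrict_vec T b, support b - T)"
      \<comment> \<open>\<open>d\<close> nonzero coordinates with sum \<open>d\<close> are all 1, so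
        the pattern and the outer support determine the vector.\<close>
      have one: "c i = 1" if c: "c \<in> N" and i: "i \<in> support c - T" for c i
      proof (rule ccontr)
        assume "c i \<noteq> 1"
        moreover have "c i \<noteq> 0" using i by (simp add: support_def)
        ultimately have "c i > 1" by simp
        have cG: "c \<in> G" and cA: "c \<in> A" using N[OF c] by (auto simp: G_def)
        have "(\<Sum>i\<in>support c - T. 1) < sum c (support c - T)"
          using supp(2)[OF cA] i \<open>c i > 1\<close>
          by (intro sum_strict_mono_ex1) (auto simp: support_def)
        then show False using N[OF c] out_sum[OF cA] by (simp add: G_def)
      qed
      have out_eq: "support a - T = support b - T" using ab(3) by simp
      show "a = b"
      proof
        fix i
        consider "i \<in> T" | "i \<notin> T" "i \<in> support a" | "i \<notin> T" "i \<notin> support a" by blast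
        then show "a i = b i"
        proof cases
          case 1
          have "restrict_vec T a i = restrict_vec T b i" using ab(3) by simp
          then show ?thesis using 1 by (simp add: restrict_vec_def)
        next
          case 2
          then have "i \<in> support a - T" by blast
          moreover from this have "i \<in> support b - T" by (simp only: out_eq)
          ultimately show ?thesis using one[OF ab(1), of i] one[OF ab(2), of i] by simp
        next
          case 3
          then have "i \<notin> support b" using out_eq by blast
          then show ?thesis using 3 by (simp add: support_def)
        qed
      qed
    qed
    have "restrict_vec T a \<in> X \<and> support a - T \<subseteq> {1..n} \<and> card (support a - T) = d"
      if "a \<in> N" for a
      using N[OF that] supp(1)[of a] by (auto simp: G_def)
    then show "(\<lambda>a. (restrict_vec T a, support a - T)) ` N \<subseteq> X \<times> {D. D \<subseteq> {1..n} \<and> card D = d}"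
      by auto
    show "finite (X \<times> {D. D \<subseteq> {1..n} \<and> card D = d})" using finX by simp
  qed
  also have "\<dots> = card X * (n choose d)"
    by (simp add: card_cartesian_product n_subsets)
  finally have cardN: "card N \<le> card X * (n choose d)" .
  have finS: "finite S"
    by (rule finite_subset[OF _ finite_bounded_nvecs[of n s]]) (auto simp: S_def)
  have "A \<subseteq> N \<union> S"
  proof
    fix a assume a: "a \<in> A"
    have "card (support a - T') \<le> card (support a - T)"
      using supp(2)[OF a] by (intro card_mono) (auto simp: T'_def)
    then have "card (support a - T') \<le> d" using Td[OF a] by simp
    then show "a \<in> N \<union> S" using a A(1) le_s[OF a] by (auto simp: N_def S_def)
  qed
  moreover have "finite N" using finite_wise_union[OF r1 A] by (simp add: N_def)
  ultimately have "card A \<le> card N + card S"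
    using finS by (meson card_Un_le card_mono finite_UnI order_trans)
  then have cardA: "card A \<le> card X * (n choose d)
      + (if d = 0 then 0 else (n + 1) ^ (d - 1) * (s + 1) ^ (t' + (d - 1)))"
    using cardN card_sparse_le[OF finT' cardT', of n s d] unfolding S_def by linarith

  show ?thesis
  proof (cases "card X < 2 ^ p")
    case True
    then have "card X * (n choose d) \<le> (2 ^ p - 1) * (n choose d)" by (intro mult_right_mono) auto
    then show ?thesis using cardA by linarith
  next
    case False
    \<comment> \<open>Here 2^p \<le> \<open>card X\<close> \<le> (product of the
      \<open>z i + 1\<close>) \<le> 2^(\<open>sum z T\<close>) \<le> 2^p, so equality holds
      throughout. Hence \<open>z\<close> is 0/1 on \<open>T\<close> with sum \<open>p\<close>, and
      every vector of the box \<open>Z\<close> is popular, in particular its top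
      \<open>z0\<close>.\<close>
    have prod_eq: "\<not> (\<Prod>i\<in>T. z i + 1) < 2 ^ p" using False cardX by linarith
    have z1: "z i \<le> 1" if "i \<in> T" for i
    proof (rule ccontr)
      assume "\<not> z i \<le> 1"
      then have "(\<Prod>i\<in>T. z i + 1) < 2 ^ sum z T"
        by (intro prod_Suc_less_power_sum[OF finT that]) simp
      then show False using pow_le prod_eq by linarith
    qed
    have sum_z: "sum z T = p"
    proof (rule ccontr)
      assume "sum z T \<noteq> p"
      then have "(2::nat) ^ sum z T < 2 ^ p" using z(2) by (intro power_strict_increasing) auto
      then show False using prod_eq prod_Suc_le_power_sum[OF finT, of z] by linarith
    qed
    have "card Z \<le> card X"
      using Z(2) prod_Suc_le_power_sum[OF finT, of z] pow_le False by linarith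
    then have "X = Z" using XZ Z(1) by (intro card_seteq)
    define z0 where "z0 = restrict_vec T z"
    have "z0 \<in> X" unfolding \<open>X = Z\<close> by (simp add: Z_def z0_def restrict_vec_def)
    have z0T: "sum z0 T = p"
      using sum_z by (simp add: z0_def restrict_vec_def)
    have z0_out: "z0 i = 0" if "i \<notin> T" for i using that by (simp add: z0_def restrict_vec_def)
    have split: "weight n a = sum a T + out a" for a
      unfolding weight_def out_def using T(1) by (subst sum.subset_diff[of T]) auto
    have "out z0 = 0" by (simp add: out_def z0_out)
    then have "weight n z0 = p" using split z0T by simp
    moreover have "z0 \<in> nvecs n" using T(1) z0_out unfolding nvecs_def by blast
    moreover have "z0 i \<le> 1" for i using z1 by (simp add: z0_def restrict_vec_def)
    moreover have "weight n (\<lambda>i. max (a i) (z0 i)) \<le> p + d" if a: "a \<in> A" for a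
    proof -
      have "\<exists>b. b 0 = a \<and> (\<forall>j\<in>{1..r-1}. b j \<in> G \<and> kind (b j) = (z0, False)) \<and>
        (\<forall>j\<le>r-1. \<forall>k\<le>r-1. j \<noteq> k \<longrightarrow> support (b j) \<inter> support (b k) \<subseteq> T)"
        using \<open>z0 \<in> X\<close> supp[OF a] by (intro choice) (auto simp: X_def)
      then obtain b where b: "b 0 = a" "\<forall>j\<in>{1..r-1}. b j \<in> G \<and> kind (b j) = (z0, False)"
        "\<forall>j\<le>r-1. \<forall>k\<le>r-1. j \<noteq> k \<longrightarrow> support (b j) \<inter> support (b k) \<subseteq> T" by blast
      \<comment> \<open>The shift puts \<open>a\<close> in place 1 and members with pattern
        \<open>z0\<close> in places 2 to \<open>r\<close>.\<close>
      define c where "c j = b (j - 1)" for j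
      have c1: "c 1 = a" using b(1) by (simp add: c_def)
      have c: "c j \<in> G \<and> kind (c j) = (z0, False)" if "j \<in> {2..r}" for j
        unfolding c_def using that by (intro b(2)[rule_format]) auto
      have cz: "z0 i = c 2 i" if "i \<in> T" for i
        using c[of 2] r that kindD[of "c 2" z0 False i] by simp
      \<comment> \<open>On \<open>T\<close> the maximum is covered by \<open>c 1\<close> and
        \<open>c 2\<close>, which exist as r \<ge> 2. The other \<open>r - 1\<close> outer parts use
        at least (r - 1) d of s = d r + p, leaving at most p + d.\<close>
      have "(\<Sum>i\<in>T. max (a i) (z0 i)) + (\<Sum>j=1..r. out (c j)) \<le> s"
      proof (rule join_bound)
        show "c j \<in> A" if "j \<in> {1..r}" for j
          using that c[of j] c1 a by (cases "j = 1") (auto simp: G_def)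
        show "\<exists>j\<in>{1..r}. max (a i) (z0 i) \<le> c j i" if "i \<in> T" for i
        proof (cases "z0 i \<le> a i")
          case True
          then show ?thesis using c1 r by (intro bexI[of _ 1]) auto
        next
          case False
          then show ?thesis using cz[OF that] r by (intro bexI[of _ 2]) auto
        qed
        show "support (c j) \<inter> support (c k) \<subseteq> T"
          if "j \<in> {1..r}" "k \<in> {1..r}" "j \<noteq> k" for j k
          unfolding c_def using that by (intro b(3)[rule_format]) auto
      qed
      moreover have "(\<Sum>j=1..r. out (c j)) = out a + (\<Sum>j=2..r. out (c j))"
        using r c1 by (simp add: sum.atLeast_Suc_atMost numeral_2_eq_2)
      moreover have "(\<Sum>j=2..r. d) \<le> (\<Sum>j=2..r. out (c j))"
        using c out_ge by (intro sum_mono) auto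
      moreover have "(\<Sum>j=2..r. d) + d = d * r"
        using r by (cases r) (auto simp: algebra_simps)
      moreover have "out (\<lambda>i. max (a i) (z0 i)) = out a"
        unfolding out_def by (rule sum.cong) (auto simp: z0_out)
      ultimately show ?thesis using split[of "\<lambda>i. max (a i) (z0 i)"] s by linarith
    qed
    ultimately show ?thesis by (intro disjI2 bexI[of _ z0] conjI allI ballI) simp_all
  qed
qed

section \<open>The extremal family\<close>

text \<open>The weight of the maximum exceeds that of \<open>z\<close> by exactly the weight of the
  truncated difference \<open>c - z\<close>, the least increment of \<open>z\<close> that reaches
  above \<open>c\<close>.\<close>

lemma down_family_up_eq:
  assumes n: "n \<ge> 1" and z: "z \<in> nvecs n"
  shows "down_family n (up n z d) = {c \<in> nvecs n. weight n (\<lambda>i. max (c i) (z i)) \<le> weight n z + d}"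
proof (intro equalityI subsetI)
  fix c assume "c \<in> down_family n (up n z d)"
  then obtain e where e: "weight n e = d" "c \<in> nvecs n" "c \<le> (\<lambda>i. z i + e i)"
    by (auto simp: down_family_def down_def up_def)
  have "weight n (\<lambda>i. max (c i) (z i)) \<le> weight n (\<lambda>i. z i + e i)"
    using e(3) by (intro weight_mono) (auto simp: le_fun_def)
  also have "\<dots> = weight n z + d" using e(1) by (simp add: weight_def sum.distrib)
  finally show "c \<in> {c \<in> nvecs n. weight n (\<lambda>i. max (c i) (z i)) \<le> weight n z + d}"
    using e(2) by simp
next
  fix c assume "c \<in> {c \<in> nvecs n. weight n (\<lambda>i. max (c i) (z i)) \<le> weight n z + d}"
  then have c: "c \<in> nvecs n" "weight n (\<lambda>i. max (c i) (z i)) \<le> weight n z + d" by auto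
  define e where "e i = c i - z i" for i
  have "weight n (\<lambda>i. max (c i) (z i)) = weight n z + weight n e"
    unfolding weight_def sum.distrib[symmetric] by (rule sum.cong) (auto simp: e_def)
  then have we: "weight n e \<le> d" using c(2) by simp
  \<comment> \<open>\<open>up\<close> demands an increment of weight exactly \<open>d\<close>; the
    deficit goes to coordinate 1, which exists since n \<ge> 1.\<close>
  define e' where "e' i = e i + (if i = 1 then d - weight n e else 0)" for i
  have "weight n e' = weight n e + (\<Sum>i=1..n. if i = 1 then d - weight n e else 0)"
    unfolding e'_def by (simp add: weight_def sum.distrib)
  also have "\<dots> = d" using n we by simp
  finally have "weight n e' = d" .
  moreover have "e' \<in> nvecs n" using c(1) n by (auto simp: e'_def e_def nvecs_def)
  ultimately have "(\<lambda>i. z i + e' i) \<in> up n z d" by (auto simp: up_def)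
  moreover have "c \<in> down n (\<lambda>i. z i + e' i)"
    using c(1) by (auto simp: down_def le_fun_def e'_def e_def)
  ultimately show "c \<in> down_family n (up n z d)" by (auto simp: down_family_def)
qed

lemma initial_vec_eq: "initial_vec p = (\<lambda>k. if k \<in> {1..p} then 1 else 0)"
  by (auto simp: initial_vec_def unit_vec_def fun_eq_iff)

lemma initial_vec_nvecs: "p \<le> n \<Longrightarrow> initial_vec p \<in> nvecs n"
  by (auto simp: initial_vec_eq nvecs_def)

lemma weight_indicator:
  assumes "D \<subseteq> {1..n}"
  shows "weight n (\<lambda>k. if k \<in> D then 1 else 0) = card D"
proof -
  have "{1..n} \<inter> D = D" using assms by auto
  then show ?thesis by (simp add: weight_def sum.If_cases)
qed

lemma weight_initial_vec: "p \<le> n \<Longrightarrow> weight n (initial_vec p) = p"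
  unfolding initial_vec_eq by (subst weight_indicator) auto

text \<open>Only 0/1 vectors are counted: any subset of \<open>{1..p}\<close> joined with any
  \<open>d\<close>-subset of \<open>{p+1..n}\<close>. They already give the leading term.\<close>

lemma card_extremal_ge:
  assumes n: "n \<ge> 1" and p: "p \<le> n"
  shows "2 ^ p * ((n - p) choose d) \<le> card (down_family n (up n (initial_vec p) d))"
proof -
  define I where "I D = (\<lambda>k. if k \<in> D then 1 else 0 :: nat)" for D :: "nat set"
  let ?D = "{D. D \<subseteq> {p+1..n} \<and> card D = d}"
  have I_inj: "I D = I E \<Longrightarrow> D = E" for D E
    by (auto simp: I_def fun_eq_iff split: if_splits)
  have "card (Pow {1..p} \<times> ?D) \<le> card (down_family n (up n (initial_vec p) d))"
  proof (rule card_inj_on_le)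
    show "inj_on (\<lambda>(P, D). I (P \<union> D)) (Pow {1..p} \<times> ?D)"
    proof (rule inj_onI, clarify)
      fix P D P' D'
      assume *: "P \<subseteq> {1..p}" "P' \<subseteq> {1..p}" "D \<subseteq> {p+1..n}" "D' \<subseteq> {p+1..n}"
        "I (P \<union> D) = I (P' \<union> D')"
      then have "P \<union> D = P' \<union> D'" using I_inj by blast
      moreover have "P = (P \<union> D) \<inter> {1..p}" "P' = (P' \<union> D') \<inter> {1..p}"
        "D = (P \<union> D) \<inter> {p+1..n}" "D' = (P' \<union> D') \<inter> {p+1..n}"
        using *(1-4) by fastforce+
      ultimately show "P = P' \<and> D = D'" by metis
    qed
    show "(\<lambda>(P, D). I (P \<union> D)) ` (Pow {1..p} \<times> ?D) \<subseteq> down_family n (up n (initial_vec p) d)"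
    proof clarify
      fix P D assume PD: "P \<subseteq> {1..p}" "D \<subseteq> {p+1..n}" "d = card D"
      have "(\<lambda>i. max (I (P \<union> D) i) (initial_vec p i)) = I ({1..p} \<union> D)"
        using PD(1) by (auto simp: I_def initial_vec_eq fun_eq_iff)
      moreover have "weight n (I ({1..p} \<union> D)) = card ({1..p} \<union> D)"
        unfolding I_def using PD(2) p by (intro weight_indicator) auto
      moreover have "card ({1..p} \<union> D) \<le> p + d"
        using card_Un_le[of "{1..p}" D] PD(3) by simp
      moreover have "I (P \<union> D) \<in> nvecs n"
        using PD p by (auto simp: I_def nvecs_def)
      ultimately show "I (P \<union> D) \<in> down_family n (up n (initial_vec p) (card D))"
        using PD(3) p by (simp add: down_family_up_eq[OF n initial_vec_nvecs] weight_initial_vec)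
    qed
    show "finite (down_family n (up n (initial_vec p) d))" by (rule finite_down_family_up)
  qed
  then show ?thesis using p by (simp add: card_cartesian_product card_Pow n_subsets)
qed

lemma isomorphic_extremal:
  assumes n: "n \<ge> 1" and z: "z \<in> nvecs n" "\<And>i. z i \<le> 1" "weight n z = p"
  shows "isomorphic_families n (down_family n (up n z d)) (down_family n (up n (initial_vec p) d))"
proof -
  have zi: "z i = (if i \<in> support z then 1 else 0)" for i
    using z(2)[of i] by (auto simp: support_def)
  then have "weight n z = weight n (\<lambda>i. if i \<in> support z then 1 else 0)"
    by (intro arg_cong[of _ _ "weight n"] ext)
  also have "\<dots> = card (support z)"
    by (rule weight_indicator[OF support_subset[OF z(1)]])
  finally have card_supp: "card (support z) = p" using z(3) by simp
  have supp: "support z \<subseteq> {1..n}" by (rule support_subset[OF z(1)])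
  have p: "p \<le> n" using card_mono[OF _ supp] card_supp by simp
  obtain f where f: "bij_betw f {1..p} (support z)"
    using finite_same_card_bij[of "{1..p}" "support z"] card_supp finite_support[OF z(1)] by auto
  have "card ({1..n} - {1..p}) = card ({1..n} - support z)"
    using supp p card_supp finite_support[OF z(1)] by (simp add: card_Diff_subset)
  then obtain g where g: "bij_betw g ({1..n} - {1..p}) ({1..n} - support z)"
    using finite_same_card_bij[of "{1..n} - {1..p}" "{1..n} - support z"] by auto
  \<comment> \<open>Since \<open>a \<circ> \<pi>\<close> reads coordinate \<open>\<pi> i\<close> at
    place \<open>i\<close>, the set \<open>{1..p}\<close> has to be sent onto
    \<open>support z\<close>, not conversely.\<close>
  define \<pi> where "\<pi> i = (if i \<in> {1..p} then f i else if i \<in> {1..n} then g i else i)" for i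
  have "bij_betw \<pi> {1..p} (support z)"
    using f by (rule bij_betw_cong[THEN iffD1, rotated]) (auto simp: \<pi>_def)
  moreover have "bij_betw \<pi> ({1..n} - {1..p}) ({1..n} - support z)"
    using g by (rule bij_betw_cong[THEN iffD1, rotated]) (auto simp: \<pi>_def)
  ultimately have "bij_betw \<pi> ({1..p} \<union> ({1..n} - {1..p})) (support z \<union> ({1..n} - support z))"
    by (rule bij_betw_combine) auto
  moreover have "{1..p} \<union> ({1..n} - {1..p}) = {1..n}" "support z \<union> ({1..n} - support z) = {1..n}"
    using p supp by auto
  ultimately have "bij_betw \<pi> {1..n} {1..n}" by simp
  then have perm: "\<pi> permutes {1..n}"
    by (rule bij_imp_permutes) (use p in \<open>auto simp: \<pi>_def\<close>)
  have z\<pi>: "z (\<pi> i) = initial_vec p i" for i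
  proof -
    have "\<pi> i \<in> support z \<longleftrightarrow> i \<in> {1..p}"
    proof (cases "i \<in> {1..p}")
      case True
      then show ?thesis using bij_betwE[OF f] by (auto simp: \<pi>_def)
    next
      case False
      then show ?thesis using bij_betwE[OF g] supp by (auto simp: \<pi>_def)
    qed
    then show ?thesis using zi[of "\<pi> i"] by (simp add: initial_vec_eq)
  qed
  have weight_perm: "weight n (a \<circ> \<sigma>) = weight n a" if "\<sigma> permutes {1..n}" for a \<sigma>
    unfolding weight_def using sum.permute[OF that, of a] by simp
  have nvecs_perm: "a \<circ> \<sigma> \<in> nvecs n" if "a \<in> nvecs n" "\<sigma> permutes {1..n}" for a \<sigma>
    using that(1) permutes_in_image[OF that(2)] by (auto simp: nvecs_def)
  have max_perm: "weight n (\<lambda>i. max (c (\<pi> i)) (initial_vec p i)) = weight n (\<lambda>i. max (c i) (z i))" for c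
    using weight_perm[OF perm, of "\<lambda>i. max (c i) (z i)"] by (simp add: z\<pi> o_def)
  let ?F = "{c \<in> nvecs n. weight n (\<lambda>i. max (c i) (z i)) \<le> p + d}"
  let ?E = "{c \<in> nvecs n. weight n (\<lambda>i. max (c i) (initial_vec p i)) \<le> p + d}"
  have "?E = (\<lambda>a. a \<circ> \<pi>) ` ?F"
  proof (intro equalityI subsetI)
    fix c assume c: "c \<in> ?E"
    define c' where "c' = c \<circ> inv \<pi>"
    have c'\<pi>: "c' \<circ> \<pi> = c"
      using permutes_inv_o(2)[OF perm] by (simp add: c'_def o_assoc[symmetric])
    have "c' \<in> nvecs n"
      unfolding c'_def using c by (intro nvecs_perm permutes_inv[OF perm]) auto
    moreover have "weight n (\<lambda>i. max (c' i) (z i)) \<le> p + d"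
      using c max_perm[of c'] fun_cong[OF c'\<pi>] by simp
    ultimately show "c \<in> (\<lambda>a. a \<circ> \<pi>) ` ?F" using c'\<pi> by (intro image_eqI[of _ _ c']) auto
  next
    fix c assume "c \<in> (\<lambda>a. a \<circ> \<pi>) ` ?F"
    then obtain a where "c = a \<circ> \<pi>" "a \<in> ?F" by blast
    then show "c \<in> ?E" using max_perm[of a] nvecs_perm[OF _ perm, of a] by simp
  qed
  then show ?thesis
    unfolding isomorphic_families_def down_family_up_eq[OF n z(1)]
      down_family_up_eq[OF n initial_vec_nvecs[OF p]] z(3) weight_initial_vec[OF p]
    using perm by blast
qed

lemma card_isomorphic_families:
  assumes "isomorphic_families n A B"
  shows "card A = card B"
proof -
  obtain \<pi> where \<pi>: "\<pi> permutes {1..n}" "B = (\<lambda>a. a \<circ> \<pi>) ` A"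
    using assms by (auto simp: isomorphic_families_def)
  have "inj_on (\<lambda>a. a \<circ> \<pi>) A"
  proof (rule inj_onI)
    fix a b assume "a \<circ> \<pi> = b \<circ> \<pi>"
    then have "(a \<circ> \<pi>) \<circ> inv \<pi> = (b \<circ> \<pi>) \<circ> inv \<pi>" by simp
    then show "a = b" using permutes_inv_o(1)[OF \<pi>(1)] by (simp add: o_assoc[symmetric])
  qed
  then show ?thesis using \<pi>(2) by (simp add: card_image)
qed

section \<open>Comparison of the counts\<close>

lemma binomial_le_power: "(n choose k) \<le> n ^ k"
  by (cases "k \<le> n") (simp_all add: binomial_le_pow binomial_eq_0)

text \<open>Pascal's rule is applied \<open>p\<close> times, each time losing at most n^e.\<close>

lemma binomial_diff_le: "(n choose Suc e) \<le> ((n - p) choose Suc e) + p * n ^ e"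
proof (induction p)
  case (Suc p)
  have "((n - p) choose Suc e) \<le> ((n - Suc p) choose Suc e) + n ^ e"
  proof (cases "n - p")
    case (Suc m)
    have "m choose e \<le> n ^ e"
      using binomial_le_power[of m e] power_mono[of m n e] Suc by linarith
    moreover have "n - Suc p = m" using Suc by simp
    ultimately show ?thesis using Suc by simp
  qed simp
  then show ?case using Suc.IH by simp
qed simp

text \<open>Up to O(n^(d-1)), the right side exceeds the left by n choose d. For d = 0 the claim is
  2^p - 1 < 2^p.\<close>

lemma eventually_binomial_gap:
  fixes K :: nat
  shows "\<exists>n0. \<forall>n>n0. (2 ^ p - 1) * (n choose d) + (if d = 0 then 0 else (n + 1) ^ (d - 1) * K)
    < 2 ^ p * ((n - p) choose d)"
proof (cases d)
  case 0
  then show ?thesis by simp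
next
  case (Suc e)
  \<comment> \<open>The first summand pays for replacing n by n - p in the binomial, the second for
    the error term, with n + 1 \<le> 2n. The threshold \<open>C * d ^ d\<close> comes from the bound
    n choose d \<ge> (n/d)^d.\<close>
  define C where "C = 2 ^ p * p + 2 ^ e * K"
  have "(2 ^ p - 1) * (n choose d) + (n + 1) ^ e * K < 2 ^ p * ((n - p) choose d)"
    if n: "n > max d (C * d ^ d)" for n
  proof -
    have "(real n / real d) ^ d \<le> real (n choose d)"
      using n by (intro binomial_ge_n_over_k_pow_k) auto
    then have "real n ^ d \<le> real (n choose d) * real d ^ d"
      using Suc by (simp add: power_divide pos_divide_le_eq del: of_nat_Suc)
    then have "n ^ d \<le> (n choose d) * d ^ d"
      by (metis of_nat_le_iff of_nat_mult of_nat_power)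
    moreover have "C * d ^ d * n ^ e < n * n ^ e" using n by (intro mult_strict_right_mono) auto
    moreover have "n * n ^ e = n ^ d" using Suc by simp
    moreover have "C * d ^ d * n ^ e = C * n ^ e * d ^ d" by (simp add: mult_ac)
    ultimately have "C * n ^ e * d ^ d < (n choose d) * d ^ d" by linarith
    then have C: "C * n ^ e < (n choose d)" by simp
    have "(n + 1) ^ e \<le> (2 * n) ^ e" using n by (intro power_mono) auto
    then have "(n + 1) ^ e * K \<le> 2 ^ e * K * n ^ e"
      using mult_right_mono[of "(n + 1) ^ e" "(2 * n) ^ e" K] by (simp add: power_mult_distrib mult_ac)
    moreover have "2 ^ p * (n choose d) \<le> 2 ^ p * ((n - p) choose d) + 2 ^ p * p * n ^ e"
      using mult_left_mono[OF binomial_diff_le[of n e p], of "2 ^ p"] Suc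
      by (simp add: distrib_left mult.assoc)
    moreover have "(2 ^ p - 1) * (n choose d) + (n choose d) = 2 ^ p * (n choose d)"
      by (simp add: diff_mult_distrib)
    moreover have "2 ^ p * p * n ^ e + 2 ^ e * K * n ^ e < (n choose d)"
      using C by (simp add: C_def distrib_right)
    ultimately show ?thesis by linarith
  qed
  then show ?thesis using Suc by (intro exI[of _ "max d (C * d ^ d)"]) simp
qed

theorem theorem1:
  fixes r s d p :: nat
  assumes "r \<ge> 2" and "s \<ge> 1" and "s = d * r + p" and "p < r"
  shows "\<exists>n0::nat. \<forall>n>n0. \<forall>A. A \<subseteq> nvecs n \<and> wise_union n r s A \<longrightarrow>
           card A \<le> card (down_family n (up n (initial_vec p) d)) \<and>
           (card A = card (down_family n (up n (initial_vec p) d)) \<longrightarrow>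
              isomorphic_families n A (down_family n (up n (initial_vec p) d)))"
proof -
  define t' where "t' = r * s + 2 * (s + 1) ^ (r * s) * (r * s)"
  obtain n1 where n1: "\<forall>n>n1. (2 ^ p - 1) * (n choose d)
      + (if d = 0 then 0 else (n + 1) ^ (d - 1) * (s + 1) ^ (t' + (d - 1)))
    < 2 ^ p * ((n - p) choose d)"
    using eventually_binomial_gap[of p d "(s + 1) ^ (t' + (d - 1))"] by blast
  have "card A \<le> card (down_family n (up n (initial_vec p) d)) \<and>
      (card A = card (down_family n (up n (initial_vec p) d)) \<longrightarrow>
        isomorphic_families n A (down_family n (up n (initial_vec p) d)))"
    if n: "n > max n1 p" and A: "A \<subseteq> nvecs n" "wise_union n r s A" for n A
  proof -
    have n_pos: "n \<ge> 1" and pn: "p \<le> n" and "n > n1" using n by auto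
    from large_family_structure[OF assms(1,3,4) A] show ?thesis
    proof
      \<comment> \<open>In this case the inequality is strict, so the claim about equality is
        vacuous.\<close>
      assume "card A \<le> (2 ^ p - 1) * (n choose d)
        + (if d = 0 then 0 else (n + 1) ^ (d - 1) * (s + 1) ^
            (r * s + 2 * (s + 1) ^ (r * s) * (r * s) + (d - 1)))"
      also have "\<dots> < 2 ^ p * ((n - p) choose d)"
        using n1 \<open>n > n1\<close> unfolding t'_def by blast
      also have "\<dots> \<le> card (down_family n (up n (initial_vec p) d))"
        by (rule card_extremal_ge[OF n_pos pn])
      finally show ?thesis by simp
    next
      assume "\<exists>z\<in>nvecs n. (\<forall>i. z i \<le> 1) \<and> weight n z = p \<and>
        (\<forall>a\<in>A. weight n (\<lambda>i. max (a i) (z i)) \<le> p + d)"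
      then obtain z where z: "z \<in> nvecs n" "\<And>i. z i \<le> 1" "weight n z = p"
        "\<forall>a\<in>A. weight n (\<lambda>i. max (a i) (z i)) \<le> p + d" by blast
      have iso: "isomorphic_families n (down_family n (up n z d)) (down_family n (up n (initial_vec p) d))"
        by (rule isomorphic_extremal[OF n_pos z(1-3)])
      have sub: "A \<subseteq> down_family n (up n z d)"
        using z(3,4) A(1) by (auto simp: down_family_up_eq[OF n_pos z(1)])
      \<comment> \<open>\<open>A\<close> lies in a finite isomorphic copy of the extremal family, so
        equal cardinality makes it the whole copy.\<close>
      show ?thesis
        using card_mono[OF finite_down_family_up sub] card_subset_eq[OF finite_down_family_up sub]
          card_isomorphic_families[OF iso] iso by auto
    qed
  qed
  then show ?thesis by (intro exI[of _ "max n1 p"]) blast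
qed

end
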